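(* Let $n\ge 2$, let $V\in\mathbb{R}^{n\times n}$ be a nonsingular covariance matrix (symmetric positive definite) and let $\eta=\operatorname{diag}(V)$. For $\sigma>0$ with $\sigma^2\ge\sigma_{\mathrm{mvp}}^2$, let $\mathbf w(\sigma)$ be an optimal solution of $$\max\ q(\mathbf w)\quad\text{s.t.}\quad \mathbf 1_n^\top\mathbf w=1,\ \ \mathbf w^\top V\mathbf w=\sigma^2 .$$ Then $$\eta^\top\mathbf w(\sigma)=\rho\sqrt{\sigma^2-\sigma_{\mathrm{mvp}}^2}+\frac{\mathbf 1_n^\top V^{-1}\eta}{\mathbf 1_n^\top V^{-1}\mathbf 1_n},\qquad \rho:=\sqrt{\eta^\top V^{-1}\eta-\frac{(\mathbf 1_n^\top V^{-1}\eta)^2}{\mathbf 1_n^\top V^{-1}\mathbf 1_n}} .$$ Moreover, the diversification return $q_{\mathrm{dr}}(\sigma):=q(\mathbf w(\sigma))$ of $\mathbf w(\sigma)$ is given by $$q_{\mathrm{dr}}(\sigma)=-\frac12\Big(\sqrt{\sigma^2-\sigma_{\mathrm{mvp}}^2}-\frac{\rho}{2}\Big)^2+\frac18\rho^2+q_{\mathrm{mvp}} .$$ In particular, when $\sigma=\sigma_{\mathrm{mvp}}$, the diversification return $q_{\mathrm{mvp}}$ of the minimum variance portfolio is given by $$q_{\mathrm{mvp}}=\frac12\big(\mathbf 1_n^\top V^{-1}\eta-1\big)\sigma_{\mathrm{mvp}}^2 .$$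
   Context: $\mathbf 1_n\in\mathbb{R}^n$ is the all-ones column vector and $\operatorname{diag}(V)$ is the column vector of diagonal entries of $V$. The diversification return of $\mathbf w$ with $\mathbf 1_n^\top\mathbf w=1$ is $q(\mathbf w)=\tfrac12(\eta^\top\mathbf w-\mathbf w^\top V\mathbf w)$. The minimum variance portfolio is $\mathbf w_{\mathrm{mvp}}=V^{-1}\mathbf 1_n/(\mathbf 1_n^\top V^{-1}\mathbf 1_n)$, with variance $\sigma_{\mathrm{mvp}}^2=1/(\mathbf 1_n^\top V^{-1}\mathbf 1_n)$, $\sigma_{\mathrm{mvp}}>0$, and $q_{\mathrm{mvp}}:=q(\mathbf w_{\mathrm{mvp}})$. *)

theory Defs
  imports "HOL-Analysis.Analysis"
begin

text \<open>
  Vectors of size \<open>n\<close> are elements of \<^typ>\<open>real ^ 'n\<close>, with \<open>n = CARD('n)\<close>; the constant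
  \<open>1\<close> of that type is the all-ones vector.
\<close>

definition sym_pos_def :: "real ^ 'n ^ 'n \<Rightarrow> bool" where
  "sym_pos_def V \<longleftrightarrow> transpose V = V \<and> (\<forall>x. x \<noteq> 0 \<longrightarrow> x \<bullet> (V *v x) > 0)"

definition diag_vec :: "real ^ 'n ^ 'n \<Rightarrow> real ^ 'n" where
  "diag_vec V = (\<chi> i. V $ i $ i)"

definition div_return :: "real ^ 'n ^ 'n \<Rightarrow> real ^ 'n \<Rightarrow> real" where
  "div_return V w = (1/2) * (diag_vec V \<bullet> w - w \<bullet> (V *v w))"

definition w_mvp :: "real ^ 'n ^ 'n \<Rightarrow> real ^ 'n" where
  "w_mvp V = (1 / (1 \<bullet> (matrix_inv V *v 1))) *\<^sub>R (matrix_inv V *v 1)"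

definition sigma_mvp :: "real ^ 'n ^ 'n \<Rightarrow> real" where
  "sigma_mvp V = sqrt (1 / (1 \<bullet> (matrix_inv V *v 1)))"

definition q_mvp :: "real ^ 'n ^ 'n \<Rightarrow> real" where
  "q_mvp V = div_return V (w_mvp V)"

definition optimal_portfolio :: "real ^ 'n ^ 'n \<Rightarrow> real \<Rightarrow> real ^ 'n \<Rightarrow> bool" where
  "optimal_portfolio V \<sigma> w \<longleftrightarrow>
     is_arg_max (div_return V) (\<lambda>u. 1 \<bullet> u = 1 \<and> u \<bullet> (V *v u) = \<sigma>\<^sup>2) w"

end

theory Submission
  imports Defs
begin

text \<open>
  Write \<open>A = V\<^sup>-\<^sup>1\<close>, \<open>c = 1 \<bullet> A 1\<close>, \<open>b = 1 \<bullet> A \<eta>\<close> and let \<open>x = A \<eta> - (b / c) A 1\<close>, so that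
  \<open>1 \<bullet> x = 0\<close>, \<open>V x = \<eta> - (b / c) 1\<close> and \<open>x \<bullet> V x = \<rho>\<^sup>2\<close>. If \<open>1 \<bullet> w = 1\<close>, then
  \<open>z = w - w\<^sub>m\<^sub>v\<^sub>p\<close> is \<open>V\<close>-orthogonal to the minimum variance portfolio, hence
  \<open>z \<bullet> V z = \<sigma>\<^sup>2 - \<sigma>\<^sub>m\<^sub>v\<^sub>p\<^sup>2\<close>, while \<open>\<eta> \<bullet> w = b / c + x \<bullet> V z\<close>. Cauchy--Schwarz for the form \<open>V\<close>
  bounds the last term by \<open>\<rho> sqrt (\<sigma>\<^sup>2 - \<sigma>\<^sub>m\<^sub>v\<^sub>p\<^sup>2)\<close>, and the bound is attained for \<open>z\<close> a
  nonnegative multiple of \<open>x\<close>.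
\<close>

lemma sym_pos_def_inner_commute:
  assumes "sym_pos_def V"
  shows "x \<bullet> (V *v y) = y \<bullet> (V *v x)"
  using assms unfolding sym_pos_def_def
  by (metis dot_lmul_matrix inner_commute transpose_matrix_vector)

lemma sym_pos_def_nonneg:
  assumes "sym_pos_def V"
  shows "0 \<le> x \<bullet> (V *v x)"
  using assms unfolding sym_pos_def_def by (cases "x = 0") (auto intro: less_imp_le)

text \<open>Definiteness leaves only \<open>0\<close> in the kernel of \<open>V\<close>, so
  \<open>V\<close> is invertible.\<close>

lemma sym_pos_def_inverse:
  assumes "sym_pos_def V"
  shows "V *v (matrix_inv V *v y) = y"
proof -
  have "\<forall>x. V *v x = 0 \<longrightarrow> x = 0"
    using assms unfolding sym_pos_def_def by fastforce
  then have "invertible V"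
    by (simp add: invertible_left_inverse matrix_left_invertible_ker)
  then have "V ** matrix_inv V = mat 1"
    unfolding invertible_def matrix_inv_def by (rule someI2_ex) blast
  then show ?thesis
    by (simp add: matrix_vector_mul_assoc)
qed

text \<open>The inverse inherits symmetry: apply that of \<open>V\<close> to the preimages of
  \<open>x\<close> and \<open>y\<close> under \<open>V\<close>.\<close>

lemma sym_pos_def_inner_inverse_commute:
  assumes "sym_pos_def V"
  shows "x \<bullet> (matrix_inv V *v y) = y \<bullet> (matrix_inv V *v x)"
  using sym_pos_def_inner_commute[OF assms, of "matrix_inv V *v x" "matrix_inv V *v y"]
  by (simp add: sym_pos_def_inverse[OF assms] inner_commute)

lemma sym_pos_def_Cauchy_Schwarz:
  assumes V: "sym_pos_def V"
  shows "x \<bullet> (V *v y) \<le> sqrt (x \<bullet> (V *v x)) * sqrt (y \<bullet> (V *v y))"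
proof -
  define p q where "p = sqrt (x \<bullet> (V *v x))" and "q = sqrt (y \<bullet> (V *v y))"
  have p2: "x \<bullet> (V *v x) = p\<^sup>2" and q2: "y \<bullet> (V *v y) = q\<^sup>2"
    unfolding p_def q_def by (simp_all add: sym_pos_def_nonneg[OF V])
  have p0: "0 \<le> p" and q0: "0 \<le> q"
    unfolding p_def q_def by (simp_all add: sym_pos_def_nonneg[OF V])
  show ?thesis
  proof (cases "p * q = 0")
    case True
    then have "x = 0 \<or> y = 0"
      using V p2 q2 unfolding sym_pos_def_def by fastforce
    then show ?thesis
      by auto
  next
    case False
    then have pq: "0 < p * q"
      using p0 q0 by (simp add: less_le)
    \<comment> \<open>Cross-weighting by the \<open>V\<close>-norms \<open>p\<close> and
      \<open>q\<close> gives both vectors the same \<open>V\<close>-norm \<open>p * q\<close>, so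
      the expansion has the factor \<open>p * q\<close>, which can be cancelled.\<close>
    have "0 \<le> (q *\<^sub>R x - p *\<^sub>R y) \<bullet> (V *v (q *\<^sub>R x - p *\<^sub>R y))"
      by (rule sym_pos_def_nonneg[OF V])
    also have "\<dots> = q\<^sup>2 * (x \<bullet> (V *v x)) + p\<^sup>2 * (y \<bullet> (V *v y)) - 2 * (p * q) * (x \<bullet> (V *v y))"
      using sym_pos_def_inner_commute[OF V, of y x]
      by (simp add: matrix_vector_mult_diff_distrib matrix_vector_mult_scaleR
          inner_diff_left inner_diff_right power2_eq_square algebra_simps)
    also have "\<dots> = 2 * (p * q) * (p * q - x \<bullet> (V *v y))"
      by (simp add: p2 q2 power2_eq_square algebra_simps)
    finally have "x \<bullet> (V *v y) \<le> p * q"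
      using pq by (simp add: zero_le_mult_iff)
    then show ?thesis
      by (simp add: p_def q_def)
  qed
qed

context
  fixes V :: "real ^ 'n ^ 'n"
  assumes V: "sym_pos_def V"
begin

text \<open>With \<open>u = matrix_inv V *v 1\<close>, this number is
  \<open>u \<bullet> (V *v u)\<close>, and \<open>u\<close> is nonzero since
  \<open>V *v u = 1\<close>.\<close>

lemma inner_one_inverse_one_pos: "0 < 1 \<bullet> (matrix_inv V *v 1)"
proof -
  have "matrix_inv V *v 1 \<noteq> 0"
    using sym_pos_def_inverse[OF V, of 1] by (metis matrix_vector_mult_0_right zero_neq_one)
  then show ?thesis
    using V sym_pos_def_inverse[OF V, of 1] unfolding sym_pos_def_def by (metis inner_commute)
qed

lemma sigma_mvp_squared: "(sigma_mvp V)\<^sup>2 = 1 / (1 \<bullet> (matrix_inv V *v 1))"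
  using inner_one_inverse_one_pos by (simp add: sigma_mvp_def)

lemma V_w_mvp: "V *v w_mvp V = (sigma_mvp V)\<^sup>2 *\<^sub>R 1"
  by (simp add: w_mvp_def matrix_vector_mult_scaleR sym_pos_def_inverse[OF V] sigma_mvp_squared)

lemma one_inner_w_mvp: "1 \<bullet> w_mvp V = 1"
  using inner_one_inverse_one_pos by (simp add: w_mvp_def)

lemma inner_w_mvp: "y \<bullet> w_mvp V = (1 \<bullet> (matrix_inv V *v y)) / (1 \<bullet> (matrix_inv V *v 1))"
  by (simp add: w_mvp_def sym_pos_def_inner_inverse_commute[OF V, of y 1])

text \<open>The cross terms vanish: \<open>V *v w_mvp V\<close> is a multiple of \<open>1\<close>,
  to which \<open>z\<close> is orthogonal.\<close>

lemma variance_w_mvp_add: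
  assumes "1 \<bullet> z = 0"
  shows "(w_mvp V + z) \<bullet> (V *v (w_mvp V + z)) = (sigma_mvp V)\<^sup>2 + z \<bullet> (V *v z)"
  using assms sym_pos_def_inner_commute[OF V, of "w_mvp V" z] one_inner_w_mvp
  by (simp add: matrix_vector_right_distrib inner_add_left inner_add_right V_w_mvp inner_commute)

lemma q_mvp_eq:
  "q_mvp V = (1/2) * (1 \<bullet> (matrix_inv V *v diag_vec V) - 1) * (sigma_mvp V)\<^sup>2"
  using one_inner_w_mvp
  by (simp add: q_mvp_def div_return_def inner_w_mvp V_w_mvp sigma_mvp_squared inner_commute
      diff_divide_distrib)

lemma optimal_portfolio_inner:
  fixes y :: "real ^ 'n" and \<sigma> \<rho> :: real
  assumes \<rho>: "\<rho> = sqrt (y \<bullet> (matrix_inv V *v y)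
                  - (1 \<bullet> (matrix_inv V *v y))\<^sup>2 / (1 \<bullet> (matrix_inv V *v 1)))"
    and \<sigma>: "(sigma_mvp V)\<^sup>2 \<le> \<sigma>\<^sup>2"
    and w: "1 \<bullet> w = 1" "w \<bullet> (V *v w) = \<sigma>\<^sup>2"
    and max: "\<And>u. 1 \<bullet> u = 1 \<Longrightarrow> u \<bullet> (V *v u) = \<sigma>\<^sup>2 \<Longrightarrow> y \<bullet> u \<le> y \<bullet> w"
  shows "y \<bullet> w = \<rho> * sqrt (\<sigma>\<^sup>2 - (sigma_mvp V)\<^sup>2)
           + (1 \<bullet> (matrix_inv V *v y)) / (1 \<bullet> (matrix_inv V *v 1))"
proof -
  define c b s where "c = 1 \<bullet> (matrix_inv V *v 1)" and "b = 1 \<bullet> (matrix_inv V *v y)"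
    and "s = sqrt (\<sigma>\<^sup>2 - (sigma_mvp V)\<^sup>2)"
  have c: "0 < c"
    unfolding c_def by (rule inner_one_inverse_one_pos)
  have s2: "s\<^sup>2 = \<sigma>\<^sup>2 - (sigma_mvp V)\<^sup>2"
    using \<sigma> by (simp add: s_def)
  \<comment> \<open>In the form \<open>V\<close>, \<open>x\<close> represents the functional
    \<open>y\<close> on the zero-sum hyperplane; the coefficient \<open>b / c\<close> puts
    \<open>x\<close> itself in that hyperplane.\<close>
  define x where "x = matrix_inv V *v y - (b / c) *\<^sub>R (matrix_inv V *v 1)"
  have Vx: "V *v x = y - (b / c) *\<^sub>R 1"
    by (simp add: x_def matrix_vector_mult_diff_distrib matrix_vector_mult_scaleR
        sym_pos_def_inverse[OF V])
  have one_x: "1 \<bullet> x = 0"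
    using c by (simp add: x_def inner_diff_right flip: b_def c_def)
  have y_inner: "y \<bullet> z = x \<bullet> (V *v z)" if "1 \<bullet> z = 0" for z
    using that sym_pos_def_inner_commute[OF V, of x z]
    by (simp add: Vx inner_diff_right inner_commute)
  \<comment> \<open>This identifies the radicand of \<open>\<rho>\<close> as a squared
    \<open>V\<close>-norm, hence nonnegative.\<close>
  have "x \<bullet> (V *v x) = y \<bullet> x"
    by (simp add: y_inner one_x)
  also have "\<dots> = y \<bullet> (matrix_inv V *v y) - b\<^sup>2 / c"
    by (simp add: x_def inner_diff_right sym_pos_def_inner_inverse_commute[OF V, of y 1]
        power2_eq_square flip: b_def)
  finally have x_norm: "sqrt (x \<bullet> (V *v x)) = \<rho>"
    by (simp add: \<rho> b_def c_def)
  then have xx: "x \<bullet> (V *v x) = \<rho>\<^sup>2"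
    using sym_pos_def_nonneg[OF V, of x] by (metis real_sqrt_pow2)
  have split: "y \<bullet> (w_mvp V + z) = b / c + x \<bullet> (V *v z)" if "1 \<bullet> z = 0" for z
    using that by (simp add: inner_add_right y_inner inner_w_mvp b_def c_def)
  define z where "z = w - w_mvp V"
  have wz: "w = w_mvp V + z" and one_z: "1 \<bullet> z = 0"
    using w one_inner_w_mvp by (simp_all add: z_def inner_diff_right)
  have "sqrt (z \<bullet> (V *v z)) = s"
    using w(2) variance_w_mvp_add[OF one_z] by (simp add: wz s_def)
  then have upper: "x \<bullet> (V *v z) \<le> \<rho> * s"
    using sym_pos_def_Cauchy_Schwarz[OF V, of x z] x_norm by simp
  have lower: "\<rho> * s \<le> x \<bullet> (V *v z)"
  proof (cases "\<rho> = 0")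
    case True
    then have "x = 0"
      using V xx unfolding sym_pos_def_def by fastforce
    then show ?thesis
      using True by simp
  next
    case False
    \<comment> \<open>The equality case of Cauchy-Schwarz: \<open>t\<close> points along
      \<open>x\<close> and has \<open>V\<close>-norm \<open>s\<close>, so \<open>w_mvp V + t\<close>
      is a feasible competitor of \<open>w\<close>.\<close>
    define t where "t = (s / \<rho>) *\<^sub>R x"
    have t: "1 \<bullet> t = 0" "t \<bullet> (V *v t) = s\<^sup>2" "x \<bullet> (V *v t) = \<rho> * s"
      using False
      by (simp_all add: t_def one_x matrix_vector_mult_scaleR xx power2_eq_square)
    have "y \<bullet> (w_mvp V + t) \<le> y \<bullet> w"
      using t one_inner_w_mvp variance_w_mvp_add[OF t(1)] s2
      by (intro max) (simp_all add: inner_add_right)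
    then show ?thesis
      using t split one_z by (simp add: wz)
  qed
  show ?thesis
    using split[OF one_z] upper lower by (simp add: wz b_def c_def s_def)
qed

end

theorem proposition7:
  fixes V :: "real ^ 'n ^ 'n" and \<eta> :: "real ^ 'n" and \<rho> :: real
  assumes "CARD('n) \<ge> 2"
    and "sym_pos_def V"
    and "\<eta> = diag_vec V"
    and "\<rho> = sqrt (\<eta> \<bullet> (matrix_inv V *v \<eta>)
                  - (1 \<bullet> (matrix_inv V *v \<eta>))\<^sup>2 / (1 \<bullet> (matrix_inv V *v 1)))"
  shows "(\<forall>\<sigma> w. \<sigma> > 0 \<and> \<sigma>\<^sup>2 \<ge> (sigma_mvp V)\<^sup>2 \<and> optimal_portfolio V \<sigma> w \<longrightarrow>
            \<eta> \<bullet> w = \<rho> * sqrt (\<sigma>\<^sup>2 - (sigma_mvp V)\<^sup>2)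
                      + (1 \<bullet> (matrix_inv V *v \<eta>)) / (1 \<bullet> (matrix_inv V *v 1))
          \<and> div_return V w = - (1/2) * (sqrt (\<sigma>\<^sup>2 - (sigma_mvp V)\<^sup>2) - \<rho> / 2)\<^sup>2
                              + (1/8) * \<rho>\<^sup>2 + q_mvp V)
       \<and> q_mvp V = (1/2) * (1 \<bullet> (matrix_inv V *v \<eta>) - 1) * (sigma_mvp V)\<^sup>2"
proof (intro conjI allI impI; (elim conjE)?)
  note V = \<open>sym_pos_def V\<close>
  show q: "q_mvp V = (1/2) * (1 \<bullet> (matrix_inv V *v \<eta>) - 1) * (sigma_mvp V)\<^sup>2"
    by (simp add: q_mvp_eq[OF V] assms(3))
  fix \<sigma> w
  assume \<sigma>: "(sigma_mvp V)\<^sup>2 \<le> \<sigma>\<^sup>2" and opt: "optimal_portfolio V \<sigma> w"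
  have w: "1 \<bullet> w = 1" "w \<bullet> (V *v w) = \<sigma>\<^sup>2"
    using opt unfolding optimal_portfolio_def is_arg_max_def by auto
  have best: "\<not> div_return V u > div_return V w"
    if "1 \<bullet> u = 1" "u \<bullet> (V *v u) = \<sigma>\<^sup>2" for u
    using opt that unfolding optimal_portfolio_def is_arg_max_def by auto
  \<comment> \<open>The variance is the same for all feasible portfolios, so maximising the
    diversification return amounts to maximising \<open>\<eta> \<bullet> u\<close>.\<close>
  have max: "\<eta> \<bullet> u \<le> \<eta> \<bullet> w" if "1 \<bullet> u = 1" "u \<bullet> (V *v u) = \<sigma>\<^sup>2" for u
    using best[OF that] that w by (simp add: div_return_def assms(3))
  show ret: "\<eta> \<bullet> w = \<rho> * sqrt (\<sigma>\<^sup>2 - (sigma_mvp V)\<^sup>2)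
               + (1 \<bullet> (matrix_inv V *v \<eta>)) / (1 \<bullet> (matrix_inv V *v 1))"
    by (rule optimal_portfolio_inner[OF V assms(4) \<sigma> w max])
  define s where "s = sqrt (\<sigma>\<^sup>2 - (sigma_mvp V)\<^sup>2)"
  have \<sigma>2: "\<sigma>\<^sup>2 = s\<^sup>2 + (sigma_mvp V)\<^sup>2"
    using \<sigma> by (simp add: s_def)
  have "\<eta> \<bullet> w = \<rho> * s + (1 \<bullet> (matrix_inv V *v \<eta>)) * (sigma_mvp V)\<^sup>2"
    by (simp add: ret s_def sigma_mvp_squared[OF V])
  \<comment> \<open>Up to \<open>q_mvp V\<close>, the return is
    \<open>(\<rho> * s - s\<^sup>2) / 2\<close>; complete the square in \<open>s\<close>.\<close>
  then have "div_return V w = - (1/2) * (s - \<rho> / 2)\<^sup>2 + (1/8) * \<rho>\<^sup>2 + q_mvp V"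
    unfolding div_return_def w(2) q \<sigma>2 assms(3)[symmetric]
    by (simp add: power2_eq_square field_simps)
  then show "div_return V w = - (1/2) * (sqrt (\<sigma>\<^sup>2 - (sigma_mvp V)\<^sup>2) - \<rho> / 2)\<^sup>2
               + (1/8) * \<rho>\<^sup>2 + q_mvp V"
    by (simp add: s_def)
qed

end
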